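(* Let $f=h+\overline{g}$ be a harmonic mapping of the unit disk $\mathbb{D}$ of the form $$f(z)=h(z)+\overline{g(z)}=z+\sum_{j=2}^{\infty}a_j z^j+\sum_{j=1}^{\infty}\overline{b_j z^j},\qquad |b_1|<1,$$ where $h(z)=z+\sum_{j\ge 2}a_jz^j$ and $g(z)=\sum_{j\ge1}b_jz^j$ are analytic in $\mathbb{D}$. Suppose that for some $\theta\in\mathbb{R}$ $$g'(z)=e^{i\theta}zh'(z)\quad\text{and}\quad \mathrm{Re}\left(1+z\frac{h''(z)}{h'(z)}\right)>-\frac12\qquad\text{for all } z\in\mathbb{D}.$$ Then $$|a_3-\lambda a_2^2|\le\max\left\{\frac12,\frac{|8-9\lambda|}{4}\right\}\quad\text{and}\quad |b_3-\lambda b_2^2|\le 1+\frac{|\lambda|}{4}$$ for all $\lambda\in\mathbb{R}$.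
   Context: $\mathbb{D}=\{z\in\mathbb{C}:|z|<1\}$. A complex-valued harmonic mapping of $\mathbb{D}$ is a continuous mapping whose real and imaginary parts are harmonic in $\mathbb{D}$; it can be written $h+\overline{g}$ with $h,g$ analytic in $\mathbb{D}$. *)

theory Defs
  imports "HOL-Complex_Analysis.Complex_Analysis"
begin

text \<open>A function of a complex variable is viewed as a function on the real plane: a pair
  \<open>(p, q)\<close> of partial derivatives encodes the total derivative \<open>w \<mapsto> p Re w + q Im w\<close>. In
  \<open>harmonic_on\<close>, \<open>ux\<close>, \<open>uy\<close> are the first and \<open>uxx\<close>, \<open>uxy\<close>, \<open>uyx\<close>, \<open>uyy\<close> the second partial
  derivatives of \<open>u\<close>; their continuity says that \<open>u\<close> is twice continuously differentiable.
  The set \<open>S\<close> is meant to be open.\<close>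

definition has_partials ::
  "(complex \<Rightarrow> real) \<Rightarrow> (complex \<Rightarrow> real) \<Rightarrow> (complex \<Rightarrow> real) \<Rightarrow> complex set \<Rightarrow> bool" where
  "has_partials u p q S \<longleftrightarrow>
     (\<forall>z\<in>S. (u has_derivative (\<lambda>w. p z * Re w + q z * Im w)) (at z))"

definition harmonic_on :: "(complex \<Rightarrow> real) \<Rightarrow> complex set \<Rightarrow> bool" where
  "harmonic_on u S \<longleftrightarrow>
     (\<exists>ux uy uxx uxy uyx uyy.
        has_partials u ux uy S \<and> has_partials ux uxx uxy S \<and> has_partials uy uyx uyy S \<and>
        continuous_on S uxx \<and> continuous_on S uxy \<and>
        continuous_on S uyx \<and> continuous_on S uyy \<and>
        (\<forall>z\<in>S. uxx z + uyy z = 0))"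

definition harmonic_mapping_on :: "(complex \<Rightarrow> complex) \<Rightarrow> complex set \<Rightarrow> bool" where
  "harmonic_mapping_on f S \<longleftrightarrow>
     continuous_on S f \<and> harmonic_on (\<lambda>z. Re (f z)) S \<and> harmonic_on (\<lambda>z. Im (f z)) S"

lemma has_partials_Re:
  assumes "open S" "f holomorphic_on S"
  shows "has_partials (\<lambda>z. Re (f z)) (\<lambda>z. Re (deriv f z)) (\<lambda>z. - Im (deriv f z)) S"
  unfolding has_partials_def
proof
  fix z assume "z \<in> S"
  then have "(f has_derivative (\<lambda>w. deriv f z * w)) (at z)"
    using assms by (meson has_field_derivative_imp_has_derivative holomorphic_derivI)
  from has_derivative_Re[OF this]
  show "((\<lambda>z. Re (f z)) has_derivative
      (\<lambda>w. Re (deriv f z) * Re w + - Im (deriv f z) * Im w)) (at z)"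
    by simp
qed

lemma has_partials_Im:
  assumes "open S" "f holomorphic_on S"
  shows "has_partials (\<lambda>z. Im (f z)) (\<lambda>z. Im (deriv f z)) (\<lambda>z. Re (deriv f z)) S"
  unfolding has_partials_def
proof
  fix z assume "z \<in> S"
  then have "(f has_derivative (\<lambda>w. deriv f z * w)) (at z)"
    using assms by (meson has_field_derivative_imp_has_derivative holomorphic_derivI)
  from has_derivative_Im[OF this]
  show "((\<lambda>z. Im (f z)) has_derivative
      (\<lambda>w. Im (deriv f z) * Re w + Re (deriv f z) * Im w)) (at z)"
    by (simp add: add.commute)
qed

lemma has_partials_minus:
  assumes "has_partials u p q S"
  shows "has_partials (\<lambda>z. - u z) (\<lambda>z. - p z) (\<lambda>z. - q z) S"
  unfolding has_partials_def
proof
  fix z assume "z \<in> S"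
  with assms have "((\<lambda>z. - u z) has_derivative (\<lambda>w. - (p z * Re w + q z * Im w))) (at z)"
    unfolding has_partials_def by (intro has_derivative_minus) blast
  then show "((\<lambda>z. - u z) has_derivative (\<lambda>w. - p z * Re w + - q z * Im w)) (at z)"
    by simp
qed

lemma has_partials_add:
  assumes "has_partials u p q S" "has_partials u' p' q' S"
  shows "has_partials (\<lambda>z. u z + u' z) (\<lambda>z. p z + p' z) (\<lambda>z. q z + q' z) S"
  unfolding has_partials_def
proof
  fix z assume "z \<in> S"
  with assms have "((\<lambda>z. u z + u' z) has_derivative
      (\<lambda>w. (p z * Re w + q z * Im w) + (p' z * Re w + q' z * Im w))) (at z)"
    unfolding has_partials_def by (intro has_derivative_add) blast+
  then show "((\<lambda>z. u z + u' z) has_derivative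
      (\<lambda>w. (p z + p' z) * Re w + (q z + q' z) * Im w)) (at z)"
    by (simp add: algebra_simps)
qed

lemma harmonic_on_Re:
  assumes "open S" "f holomorphic_on S"
  shows "harmonic_on (\<lambda>z. Re (f z)) S"
proof -
  have 1: "deriv f holomorphic_on S" and 2: "deriv (deriv f) holomorphic_on S"
    using assms by (simp_all add: holomorphic_deriv)
  note c = holomorphic_on_imp_continuous_on[OF 2]
  show ?thesis
    unfolding harmonic_on_def
    apply (intro exI conjI)
            apply (rule has_partials_Re[OF assms])
           apply (rule has_partials_Re[OF assms(1) 1])
          apply (rule has_partials_minus[OF has_partials_Im[OF assms(1) 1]])
         apply (auto intro!: continuous_intros c)
    done
qed

lemma harmonic_on_add:
  assumes "harmonic_on u S" "harmonic_on v S"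
  shows "harmonic_on (\<lambda>z. u z + v z) S"
proof -
  from assms(1) obtain ux uy uxx uxy uyx uyy where u:
    "has_partials u ux uy S" "has_partials ux uxx uxy S" "has_partials uy uyx uyy S"
    "continuous_on S uxx" "continuous_on S uxy" "continuous_on S uyx" "continuous_on S uyy"
    "\<forall>z\<in>S. uxx z + uyy z = 0" unfolding harmonic_on_def by blast
  from assms(2) obtain vx vy vxx vxy vyx vyy where v:
    "has_partials v vx vy S" "has_partials vx vxx vxy S" "has_partials vy vyx vyy S"
    "continuous_on S vxx" "continuous_on S vxy" "continuous_on S vyx" "continuous_on S vyy"
    "\<forall>z\<in>S. vxx z + vyy z = 0" unfolding harmonic_on_def by blast
  have lap: "\<forall>z\<in>S. (uxx z + vxx z) + (uyy z + vyy z) = 0"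
  proof
    fix z assume "z \<in> S"
    with u(8) v(8) have "uxx z + uyy z = 0" "vxx z + vyy z = 0" by blast+
    then show "(uxx z + vxx z) + (uyy z + vyy z) = 0" by linarith
  qed
  show ?thesis
    unfolding harmonic_on_def
    apply (intro exI conjI)
            apply (rule has_partials_add[OF u(1) v(1)])
           apply (rule has_partials_add[OF u(2) v(2)])
          apply (rule has_partials_add[OF u(3) v(3)])
         apply (intro continuous_on_add u v)+
    apply (rule lap)
    done
qed

lemma harmonic_mapping_on_add_cnj:
  assumes "open S" "h holomorphic_on S" "g holomorphic_on S"
  shows "harmonic_mapping_on (\<lambda>z. h z + cnj (g z)) S"
proof -
  have "harmonic_on (\<lambda>z. Re (h z) + Re (g z)) S"
    using assms by (intro harmonic_on_add harmonic_on_Re)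
  moreover have "harmonic_on (\<lambda>z. Re (- \<i> * h z) + Re (\<i> * g z)) S"
    using assms by (intro harmonic_on_add harmonic_on_Re) (auto intro!: holomorphic_intros)
  moreover have "continuous_on S (\<lambda>z. h z + cnj (g z))"
    using assms by (intro continuous_intros holomorphic_on_imp_continuous_on)
  ultimately show ?thesis
    unfolding harmonic_mapping_on_def by simp
qed

end

theory Submission
  imports Defs
begin

text \<open>Put \<open>\<phi> = h'' / (3 h' + z h'')\<close>, so that \<open>z \<phi> = (p - 1) / (p + 1)\<close> for the function
  \<open>p = 1 + (2/3) z h'' / h'\<close> of positive real part. By the Schwarz lemma \<open>\<bar>\<phi>\<bar> \<le> 1\<close>, and by the
  Schwarz--Pick inequality at the origin \<open>\<bar>\<phi>'(0)\<bar> \<le> 1 - \<bar>\<phi>(0)\<bar>\<^sup>2\<close>. Since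
  \<open>a\<^sub>2 = (3/2) \<phi>(0)\<close> and \<open>a\<^sub>3 - t a\<^sub>2\<^sup>2 = \<phi>'(0) / 2 + ((8 - 9t) / 4) \<phi>(0)\<^sup>2\<close>, the first bound is
  an affine function of \<open>\<bar>\<phi>(0)\<bar>\<^sup>2 \<in> [0,1]\<close>, maximal at an end point. The second follows from
  \<open>2 b\<^sub>2 = e\<^sup>i\<^sup>\<theta>\<close>, \<open>3 b\<^sub>3 = 2 e\<^sup>i\<^sup>\<theta> a\<^sub>2\<close> and \<open>\<bar>a\<^sub>2\<bar> \<le> 3/2\<close>.\<close>

text \<open>Composing with the disk automorphism that sends \<open>f 0\<close> to 0 gives a self-map
  of the disk fixing 0, with derivative \<open>deriv f 0 / (1 - |f 0|^2)\<close> at 0. The Schwarz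
  lemma bounds this by 1.\<close>

lemma Schwarz_Pick_origin_less:
  assumes holf: "f holomorphic_on ball 0 1"
    and lt: "\<And>z. cmod z < 1 \<Longrightarrow> cmod (f z) < 1"
  shows "cmod (deriv f 0) \<le> 1 - (cmod (f 0))\<^sup>2"
proof -
  define w where "w = f 0"
  have w1: "cmod w < 1"
    using lt[of 0] by (simp add: w_def)
  then have pos: "1 - (cmod w)\<^sup>2 > 0"
    by (simp add: power_less_one_iff)
  have ww: "1 - cnj w * w = of_real (1 - (cmod w)\<^sup>2)"
    using complex_norm_square[of w] by (simp add: mult.commute)
  define F where "F = Moebius_function 0 w \<circ> f"
  have holF: "F holomorphic_on ball 0 1"
    unfolding F_def
    by (rule holomorphic_on_compose_gen[OF holf Moebius_function_holomorphic[OF w1]])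
      (auto simp: lt)
  have F0: "F 0 = 0"
    by (simp add: F_def w_def Moebius_function_eq_zero)
  have Flt: "cmod (F z) < 1" if "cmod z < 1" for z
    using Moebius_function_norm_lt_1[OF w1 lt[OF that]] by (simp add: F_def)
  have "(f has_field_derivative deriv f 0) (at 0)"
    using holf by (rule holomorphic_derivI) auto
  moreover have "1 - cnj w * f 0 \<noteq> 0"
    using ww pos by (simp add: w_def del: of_real_diff)
  ultimately have "((\<lambda>z. (f z - w) / (1 - cnj w * f z)) has_field_derivative
      deriv f 0 / (1 - cnj w * w)) (at 0)"
    by (auto intro!: derivative_eq_intros simp: w_def)
  then have "deriv F 0 = deriv f 0 / (1 - cnj w * w)"
    by (intro DERIV_imp_deriv) (simp add: F_def Moebius_function_simple o_def)
  then have "cmod (deriv F 0) = cmod (deriv f 0) / (1 - (cmod w)\<^sup>2)"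
    using pos by (simp add: ww norm_divide del: of_real_diff)
  moreover have "cmod (deriv F 0) \<le> 1"
    by (rule Schwarz_Lemma(2)[OF holF F0 Flt, of 0]) auto
  ultimately have "cmod (deriv f 0) / (1 - (cmod w)\<^sup>2) \<le> 1"
    by simp
  then show ?thesis
    using pos by (simp only: pos_divide_le_eq mult_1 w_def)
qed

text \<open>The weak bound admits unimodular constants, for which the Moebius map above degenerates.
  The strict version is applied to \<open>s * f\<close> with \<open>0 < s < 1\<close>, and then
  \<open>s\<close> tends to 1.\<close>

lemma Schwarz_Pick_origin:
  assumes holf: "f holomorphic_on ball 0 1"
    and le: "\<And>z. cmod z < 1 \<Longrightarrow> cmod (f z) \<le> 1"
  shows "cmod (deriv f 0) \<le> 1 - (cmod (f 0))\<^sup>2"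
proof -
  have *: "s * cmod (deriv f 0) \<le> 1 - s\<^sup>2 * (cmod (f 0))\<^sup>2" if s: "0 < s" "s < 1" for s :: real
  proof -
    have "(f has_field_derivative deriv f 0) (at 0)"
      using holf by (rule holomorphic_derivI) auto
    then have d: "deriv (\<lambda>z. of_real s * f z) 0 = of_real s * deriv f 0"
      by (intro DERIV_imp_deriv) (auto intro!: derivative_eq_intros)
    have "cmod (of_real s * f z) < 1" if "cmod z < 1" for z
    proof -
      have "s * cmod (f z) \<le> s * 1"
        using le[OF that] s by (intro mult_left_mono) auto
      also have "\<dots> < 1" using s by simp
      finally show ?thesis using s by (simp add: norm_mult)
    qed
    then have "cmod (deriv (\<lambda>z. of_real s * f z) 0) \<le> 1 - (cmod (of_real s * f 0))\<^sup>2"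
      by (intro Schwarz_Pick_origin_less holomorphic_intros holf)
    then show ?thesis
      using s by (simp add: d norm_mult power_mult_distrib)
  qed
  have "((\<lambda>s. s * cmod (deriv f 0)) \<longlongrightarrow> 1 * cmod (deriv f 0)) (at_left (1::real))"
    by (intro tendsto_intros)
  moreover have "((\<lambda>s. 1 - s\<^sup>2 * (cmod (f 0))\<^sup>2) \<longlongrightarrow> 1 - 1\<^sup>2 * (cmod (f 0))\<^sup>2) (at_left (1::real))"
    by (intro tendsto_intros)
  moreover have "\<forall>\<^sub>F s in at_left (1::real). s * cmod (deriv f 0) \<le> 1 - s\<^sup>2 * (cmod (f 0))\<^sup>2"
    using eventually_at_left_real[OF zero_less_one] by eventually_elim (use * in auto)
  ultimately show ?thesis
    using tendsto_le[OF trivial_limit_at_left_real] by fastforce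
qed

text \<open>The function \<open>z * f z\<close> vanishes at 0, so the Schwarz lemma applies to it.
  Off the origin its growth bound is divided by \<open>|z|\<close>; at the origin its derivative is
  \<open>f 0\<close>.\<close>

lemma Schwarz_quotient_le_1:
  assumes holf: "f holomorphic_on ball 0 1"
    and lt: "\<And>z. cmod z < 1 \<Longrightarrow> cmod (z * f z) < 1"
    and z: "cmod z < 1"
  shows "cmod (f z) \<le> 1"
proof -
  have hol: "(\<lambda>z. z * f z) holomorphic_on ball 0 1"
    by (intro holomorphic_intros holf)
  note S = Schwarz_Lemma[OF hol _ lt z]
  show ?thesis
  proof (cases "z = 0")
    case True
    have "(f has_field_derivative deriv f 0) (at 0)"
      using holf by (rule holomorphic_derivI) auto
    then have "deriv (\<lambda>z. z * f z) 0 = f 0"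
      by (intro DERIV_imp_deriv) (auto intro!: derivative_eq_intros)
    then show ?thesis using S(2) True by simp
  next
    case False
    then show ?thesis using S(1) by (simp add: norm_mult)
  qed
qed

text \<open>Division by zero gives zero, so the assumption does not exclude a zero of \<open>k\<close> outright. It
  does make \<open>r\<^sup>3 \<bar>k(r z)\<bar>\<^sup>2\<close> nondecreasing in \<open>r\<close>, also across zeros of \<open>k\<close>.\<close>

lemma nonzero_if_Re_log_deriv_bound:
  assumes holk: "k holomorphic_on ball 0 1" and k0: "k 0 \<noteq> 0"
    and Re: "\<And>z. cmod z < 1 \<Longrightarrow> Re (z * (deriv k z / k z)) > - (3 / 2)"
    and z: "cmod z < 1"
  shows "k z \<noteq> 0"
proof
  assume kz: "k z = 0"
  \<comment> \<open>The exponent 3 matches the bound -3/2: where \<open>k u\<close> is nonzero, with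
    \<open>u = r z\<close>, the derivative is
    \<open>r^2 |k u|^2 (3 + 2 Re (u k'(u) / k u))\<close>.\<close>
  define F where "F = (\<lambda>r::real. r ^ 3 * (cmod (k (of_real r * z)))\<^sup>2)"
  have in_ball: "of_real r * z \<in> ball 0 1" if "0 \<le> r" "r \<le> 1" for r :: real
    using mult_right_mono[of r 1 "cmod z"] that z by (simp add: norm_mult)
  have deriv_F: "\<exists>y. (F has_real_derivative y) (at r) \<and> y \<ge> 0" if r: "0 \<le> r" "r \<le> 1" for r
  proof -
    define u where "u = of_real r * z"
    have u: "cmod u < 1" using in_ball[OF r] by (simp add: u_def)
    have "(k has_field_derivative deriv k u) (at u)"
      by (rule holomorphic_derivI[OF holk]) (use u in auto)
    moreover have "((\<lambda>s. of_real s * z) has_vector_derivative z) (at r)"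
      unfolding has_vector_derivative_def
      by (auto intro!: derivative_eq_intros simp: scaleR_conv_of_real)
    ultimately have "((\<lambda>s. k (of_real s * z)) has_vector_derivative z * deriv k u) (at r)"
      using field_vector_diff_chain_at[of "\<lambda>s. of_real s * z" z r k "deriv k u"]
      by (simp add: o_def u_def)
    then have dk: "((\<lambda>s. k (of_real s * z)) has_derivative (\<lambda>t. t *\<^sub>R (z * deriv k u))) (at r)"
      by (simp add: has_vector_derivative_def)
    have "((\<lambda>s. (cmod (k (of_real s * z)))\<^sup>2) has_derivative
        (\<lambda>t. 2 * (k u \<bullet> (t *\<^sub>R (z * deriv k u))))) (at r)"
      unfolding power2_norm_eq_inner
      by (rule has_derivative_eq_rhs[OF has_derivative_inner[OF dk dk]])
        (simp add: u_def inner_commute)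
    then have dN: "((\<lambda>s. (cmod (k (of_real s * z)))\<^sup>2) has_real_derivative
        2 * (k u \<bullet> (z * deriv k u))) (at r)"
      by (simp add: has_field_derivative_def mult_ac mult_commute_abs)
    have "((\<lambda>s. s ^ 3) has_real_derivative 3 * r\<^sup>2) (at r)"
      by (auto intro!: derivative_eq_intros)
    from DERIV_mult[OF this dN] have "(F has_real_derivative
        3 * r\<^sup>2 * (cmod (k u))\<^sup>2 + r ^ 3 * (2 * (k u \<bullet> (z * deriv k u)))) (at r)"
      by (simp add: F_def u_def mult_ac)
    moreover have "3 * r\<^sup>2 * (cmod (k u))\<^sup>2 + r ^ 3 * (2 * (k u \<bullet> (z * deriv k u)))
        = r\<^sup>2 * (3 * (cmod (k u))\<^sup>2 + 2 * (k u \<bullet> (u * deriv k u)))"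
    proof -
      have "u * deriv k u = r *\<^sub>R (z * deriv k u)"
        by (simp add: u_def scaleR_conv_of_real mult_ac)
      then show ?thesis by (simp add: power2_eq_square power3_eq_cube algebra_simps)
    qed
    \<comment> \<open>At a zero of \<open>k\<close> both summands vanish; elsewhere
      \<open>|k u|^2\<close> factors out and the hypothesis on the quotient applies.\<close>
    moreover have "3 * (cmod (k u))\<^sup>2 + 2 * (k u \<bullet> (u * deriv k u)) \<ge> 0"
    proof (cases "k u = 0")
      case False
      define q where "q = u * (deriv k u / k u)"
      have "u * deriv k u = q * k u" using False by (simp add: q_def)
      then have "k u \<bullet> (u * deriv k u) = Re q * (cmod (k u))\<^sup>2"
        by (simp add: inner_complex_def cmod_power2) (simp add: power2_eq_square algebra_simps)
      then have "3 * (cmod (k u))\<^sup>2 + 2 * (k u \<bullet> (u * deriv k u)) = (3 + 2 * Re q) * (cmod (k u))\<^sup>2"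
        by (simp add: algebra_simps)
      moreover have "3 + 2 * Re q \<ge> 0" using Re[OF u] by (simp add: q_def)
      ultimately show ?thesis by simp
    qed simp
    ultimately show ?thesis by (metis mult_nonneg_nonneg zero_le_power2)
  qed
  \<comment> \<open>\<open>F\<close> is nonnegative, nondecreasing and 0 at \<open>r = 1\<close>,
    hence 0 on [0,1]. The factor \<open>r^3\<close> hides the value at \<open>r = 0\<close>, so
    \<open>k 0 = 0\<close> is reached only as a limit along the segment.\<close>
  have vanish: "k (of_real r * z) = 0" if r: "0 < r" "r \<le> 1" for r :: real
  proof -
    have "F r \<le> F 1"
      by (rule DERIV_nonneg_imp_nondecreasing[OF r(2)]) (use deriv_F r in auto)
    then have "r ^ 3 * (cmod (k (of_real r * z)))\<^sup>2 \<le> 0" by (simp add: F_def kz)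
    with r show ?thesis by (auto simp: mult_le_0_iff)
  qed
  have "isCont k 0"
    using holk by (intro continuous_on_interior[OF holomorphic_on_imp_continuous_on]) auto
  then have "(k \<longlongrightarrow> k 0) (nhds 0)"
    by (simp add: isCont_def tendsto_at_iff_tendsto_nhds)
  moreover have "((\<lambda>r::real. of_real r * z) \<longlongrightarrow> of_real 0 * z) (at_right 0)"
    by (intro tendsto_intros)
  ultimately have "((\<lambda>r::real. k (of_real r * z)) \<longlongrightarrow> k 0) (at_right 0)"
    using filterlim_compose[of k "nhds (k 0)" "nhds 0"] by simp
  moreover have "\<forall>\<^sub>F r in at_right (0::real). k (of_real r * z) = 0"
    using eventually_at_right_real[OF zero_less_one] by eventually_elim (use vanish in auto)
  ultimately have "((\<lambda>r::real. 0) \<longlongrightarrow> k 0) (at_right (0::real))"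
    by (rule Lim_transform_eventually)
  with k0 show False
    using tendsto_unique[OF trivial_limit_at_right_real, of "\<lambda>_. 0" "k 0" 0 0] by auto
qed

text \<open>\<open>|3 + q|^2 - |q|^2 = 9 + 6 Re q\<close>. With \<open>p = 1 + 2q/3\<close> the
  quotient is the Cayley transform \<open>(p - 1) / (p + 1)\<close> of the right half-plane.\<close>

lemma Re_bound_imp_cmod_less:
  fixes q :: complex
  assumes "Re q > - (3 / 2)"
  shows "3 + q \<noteq> 0" "cmod (q / (3 + q)) < 1"
proof -
  show nz: "3 + q \<noteq> 0" using assms by (auto simp: complex_eq_iff)
  have "(cmod q)\<^sup>2 < (cmod (3 + q))\<^sup>2"
    using assms unfolding cmod_power2 by (simp add: power2_eq_square algebra_simps)
  then have "cmod q < cmod (3 + q)" by (rule power2_less_imp_less) simp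
  then show "cmod (q / (3 + q)) < 1" using nz by (simp add: norm_divide)
qed

theorem theorem2:
  fixes f h g :: "complex \<Rightarrow> complex" and a b :: "nat \<Rightarrow> complex" and \<theta> :: real
  assumes "harmonic_mapping_on f (ball 0 1)"
    and "h analytic_on ball 0 1" and "g analytic_on ball 0 1"
    and "\<And>z. z \<in> ball 0 1 \<Longrightarrow> f z = h z + cnj (g z)"
    and "\<And>z. z \<in> ball 0 1 \<Longrightarrow> (\<lambda>j. a (j + 2) * z ^ (j + 2)) sums (h z - z)"
    and "\<And>z. z \<in> ball 0 1 \<Longrightarrow> (\<lambda>j. b (j + 1) * z ^ (j + 1)) sums g z"
    and "cmod (b 1) < 1"
    and "\<And>z. z \<in> ball 0 1 \<Longrightarrow> deriv g z = exp (\<i> * of_real \<theta>) * z * deriv h z"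
    and "\<And>z. z \<in> ball 0 1 \<Longrightarrow> Re (1 + z * (deriv (deriv h) z / deriv h z)) > - (1 / 2)"
  shows "\<forall>t::real.
           cmod (a 3 - of_real t * (a 2)\<^sup>2) \<le> max (1 / 2) (\<bar>8 - 9 * t\<bar> / 4) \<and>
           cmod (b 3 - of_real t * (b 2)\<^sup>2) \<le> 1 + \<bar>t\<bar> / 4"
proof
  fix t :: real
  \<comment> \<open>The sequences enter the series only from index 2 (for \<open>a\<close>) and 1
    (for \<open>b\<close>) on, so the lower coefficients 0, 1 of \<open>h\<close> and 0 of
    \<open>g\<close> are written out.\<close>
  define H where "H = Abs_fps (\<lambda>n. if n = 0 then 0 else if n = 1 then 1 else a n)"
  define G where "G = Abs_fps (\<lambda>n. if n = 0 then 0 else b n)"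
  define \<epsilon> where "\<epsilon> = exp (\<i> * of_real \<theta>)"
  have H_nth: "fps_nth H 0 = 0" "fps_nth H (Suc 0) = 1" "fps_nth H 2 = a 2" "fps_nth H 3 = a 3"
    by (simp_all add: H_def)
  have G_nth: "fps_nth G 2 = b 2" "fps_nth G 3 = b 3"
    by (simp_all add: G_def)
  have near0: "\<forall>\<^sub>F z in nhds (0::complex). z \<in> ball 0 1"
    by (rule eventually_nhds_in_open) auto
  have holh: "h holomorphic_on ball 0 1"
    using assms(2) by (rule analytic_imp_holomorphic)
  then have hol1: "deriv h holomorphic_on ball 0 1" by (rule holomorphic_deriv) simp
  then have hol2: "deriv (deriv h) holomorphic_on ball 0 1" by (rule holomorphic_deriv) simp

  \<comment> \<open>Power series at the origin and nonvanishing of \<open>h'\<close>\<close>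
  have expH: "h has_fps_expansion H"
  proof (rule has_fps_expansionI, rule eventually_mono[OF near0])
    fix z :: complex assume z: "z \<in> ball 0 1"
    show "(\<lambda>n. fps_nth H n * z ^ n) sums h z"
      using assms(5)[OF z] by (subst sums_iff_shift'[of _ 2, symmetric]) (simp add: H_def eval_nat_numeral)
  qed
  have expG: "g has_fps_expansion G"
  proof (rule has_fps_expansionI, rule eventually_mono[OF near0])
    fix z :: complex assume z: "z \<in> ball 0 1"
    show "(\<lambda>n. fps_nth G n * z ^ n) sums g z"
      using assms(6)[OF z] by (subst sums_iff_shift'[of _ 1, symmetric]) (simp add: G_def)
  qed
  note exp1 = has_fps_expansion_deriv[OF expH]
  note exp2 = has_fps_expansion_deriv[OF exp1]

  have h1_0: "deriv h 0 = 1"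
    using has_fps_expansion_imp_0_eq_fps_nth_0[OF exp1] by (simp add: H_nth)
  have Re_log_deriv: "Re (z * (deriv (deriv h) z / deriv h z)) > - (3 / 2)" if "cmod z < 1" for z
    using assms(9)[of z] that by simp
  have nz: "deriv h z \<noteq> 0" if "cmod z < 1" for z
    using nonzero_if_Re_log_deriv_bound[OF hol1 _ Re_log_deriv that] by (simp add: h1_0)

  \<comment> \<open>The bounded function \<open>\<phi>\<close>\<close>
  define D where "D = (\<lambda>z. 3 * deriv h z + z * deriv (deriv h) z)"
  define \<phi> where "\<phi> = (\<lambda>z. deriv (deriv h) z / D z)"
  have D_eq: "D z = deriv h z * (3 + z * (deriv (deriv h) z / deriv h z))" if "cmod z < 1" for z
    using nz[OF that] by (simp add: D_def field_simps)
  have D_nz: "D z \<noteq> 0" if "cmod z < 1" for z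
    using nz[OF that] Re_bound_imp_cmod_less(1)[OF Re_log_deriv[OF that]] D_eq[OF that] by simp
  have hol\<phi>: "\<phi> holomorphic_on ball 0 1"
    unfolding \<phi>_def D_def by (intro holomorphic_intros hol1 hol2) (use D_nz in \<open>auto simp: D_def\<close>)
  have z\<phi>: "cmod (z * \<phi> z) < 1" if "cmod z < 1" for z
  proof -
    have "z * \<phi> z = z * (deriv (deriv h) z / deriv h z) / (3 + z * (deriv (deriv h) z / deriv h z))"
      using nz[OF that] by (simp add: \<phi>_def D_eq[OF that])
    then show ?thesis
      using Re_bound_imp_cmod_less(2)[OF Re_log_deriv[OF that]] by simp
  qed
  define c where "c = \<phi> 0"
  define d where "d = deriv \<phi> 0"
  have \<phi>_le: "cmod (\<phi> z) \<le> 1" if "cmod z < 1" for z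
    by (rule Schwarz_quotient_le_1[OF hol\<phi> z\<phi> that])
  have c_le: "cmod c \<le> 1" using \<phi>_le[of 0] by (simp add: c_def)
  have d_le: "cmod d \<le> 1 - (cmod c)\<^sup>2"
    unfolding c_def d_def by (rule Schwarz_Pick_origin[OF hol\<phi> \<phi>_le])

  \<comment> \<open>Coefficients of \<open>h\<close> in terms of \<open>\<phi>\<close>\<close>
  define P where "P = fps_expansion \<phi> 0"
  have expP: "\<phi> has_fps_expansion P"
    unfolding P_def by (rule has_fps_expansion_fps_expansion[OF _ _ hol\<phi>]) auto
  have P_nth: "fps_nth P 0 = c" "fps_nth P (Suc 0) = d"
    by (simp_all add: P_def fps_expansion_def c_def d_def)
  \<comment> \<open>The quotient defining \<open>\<phi>\<close> is multiplied out to
    \<open>h'' = \<phi> (3 h' + z h'')\<close>, so that coefficients can be compared without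
    dividing power series.\<close>
  have "(\<lambda>z. \<phi> z * (3 * deriv h z + z * deriv (deriv h) z)) has_fps_expansion
      P * (3 * fps_deriv H + fps_X * fps_deriv (fps_deriv H))"
    by (intro fps_expansion_intros expP exp1 exp2)
  moreover have "\<forall>\<^sub>F z in nhds 0. \<phi> z * (3 * deriv h z + z * deriv (deriv h) z) = deriv (deriv h) z"
    using near0 by eventually_elim (use D_nz in \<open>auto simp: \<phi>_def D_def\<close>)
  ultimately have "deriv (deriv h) has_fps_expansion
      P * (3 * fps_deriv H + fps_X * fps_deriv (fps_deriv H))"
    by (rule iffD1[OF has_fps_expansion_cong[OF _ refl], rotated])
  then have eqP: "fps_deriv (fps_deriv H) = P * (3 * fps_deriv H + fps_X * fps_deriv (fps_deriv H))"
    by (rule fps_expansion_unique_complex[OF exp2])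
  have a2: "a 2 = 3 / 2 * c"
    using arg_cong[OF eqP, of "\<lambda>F. fps_nth F 0"] H_nth P_nth
    by (simp add: eval_nat_numeral fps_numeral_nth mult_ac)
  \<comment> \<open>The coefficient of \<open>z\<close> in \<open>3 h' + z h''\<close> is
    \<open>3 * 2 a 2 + 2 a 2 = 8 a 2\<close>, and its constant term is 3.\<close>
  have a3: "6 * a 3 = 3 * d + 8 * c * a 2"
    using arg_cong[OF eqP, of "\<lambda>F. fps_nth F 1"] H_nth P_nth
    by (simp add: fps_mult_nth eval_nat_numeral fps_numeral_nth algebra_simps)

  \<comment> \<open>Coefficients of \<open>g\<close> from the dilatation\<close>
  have "(\<lambda>z. \<epsilon> * z * deriv h z) has_fps_expansion fps_const \<epsilon> * fps_X * fps_deriv H"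
    by (intro fps_expansion_intros exp1)
  moreover have "\<forall>\<^sub>F z in nhds 0. \<epsilon> * z * deriv h z = deriv g z"
    using near0 by eventually_elim (use assms(8) in \<open>simp add: \<epsilon>_def\<close>)
  ultimately have "deriv g has_fps_expansion fps_const \<epsilon> * fps_X * fps_deriv H"
    by (rule iffD1[OF has_fps_expansion_cong[OF _ refl], rotated])
  then have eqG: "fps_deriv G = fps_const \<epsilon> * (fps_X * fps_deriv H)"
    using fps_expansion_unique_complex[OF has_fps_expansion_deriv[OF expG]] by (simp add: mult.assoc)
  have b2: "b 2 = \<epsilon> / 2"
    using arg_cong[OF eqG, of "\<lambda>F. fps_nth F 1"] H_nth G_nth
    by (simp add: eval_nat_numeral field_simps)
  have b3: "b 3 = \<epsilon> * c"
    using arg_cong[OF eqG, of "\<lambda>F. fps_nth F 2"] H_nth G_nth a2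
    by (simp add: eval_nat_numeral field_simps)
  have \<epsilon>: "cmod \<epsilon> = 1" by (simp add: \<epsilon>_def)

  \<comment> \<open>The two estimates\<close>
  define x where "x = (cmod c)\<^sup>2"
  define M where "M = max (1 / 2) (\<bar>8 - 9 * t\<bar> / 4)"
  have x: "0 \<le> x" "x \<le> 1" using c_le by (simp_all add: x_def power_le_one)
  \<comment> \<open>Inserting \<open>a 2 = 3c/2\<close> gives \<open>a 3 = d/2 + 2 c^2\<close>, and
    \<open>2 - 9t/4 = (8 - 9t)/4\<close>.\<close>
  have "a 3 - of_real t * (a 2)\<^sup>2 = d / 2 + of_real ((8 - 9 * t) / 4) * c\<^sup>2"
  proof -
    have "6 * a 3 = 6 * (d / 2 + 2 * c\<^sup>2)"
      using a3 by (simp add: a2 power2_eq_square algebra_simps)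
    then have "a 3 = d / 2 + 2 * c\<^sup>2"
      by (simp only: mult_cancel_left) simp
    then show ?thesis by (simp only:) (simp add: a2 field_simps power2_eq_square)
  qed
  also have "cmod \<dots> \<le> cmod (d / 2) + cmod (of_real ((8 - 9 * t) / 4) * c\<^sup>2)"
    by (rule norm_triangle_ineq)
  also have "\<dots> = cmod d / 2 + \<bar>8 - 9 * t\<bar> / 4 * x"
    by (simp only: norm_mult norm_divide norm_power norm_of_real x_def) simp
  also have "\<dots> \<le> (1 / 2) * (1 - x) + \<bar>8 - 9 * t\<bar> / 4 * x"
    using d_le by (simp add: x_def)
  \<comment> \<open>A convex combination, with weights \<open>1 - x\<close> and \<open>x\<close>, of
    the two numbers whose maximum is \<open>M\<close>.\<close>
  also have "\<dots> \<le> M * (1 - x) + M * x"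
    using x by (intro add_mono mult_right_mono) (auto simp: M_def)
  also have "\<dots> = M" by (simp add: algebra_simps)
  finally have A: "cmod (a 3 - of_real t * (a 2)\<^sup>2) \<le> M" .

  have "cmod (b 3 - of_real t * (b 2)\<^sup>2) \<le> cmod (b 3) + cmod (of_real t * (b 2)\<^sup>2)"
    by (rule norm_triangle_ineq4)
  \<comment> \<open>Here \<open>|b 3| = |c|\<close>, which is at most 1, and
    \<open>|b 2|^2 = 1/4\<close>.\<close>
  also have "\<dots> \<le> 1 + \<bar>t\<bar> / 4"
    using c_le \<epsilon> by (simp add: b2 b3 norm_mult norm_divide norm_power power_divide)
  finally show "cmod (a 3 - of_real t * (a 2)\<^sup>2) \<le> max (1 / 2) (\<bar>8 - 9 * t\<bar> / 4) \<and>
      cmod (b 3 - of_real t * (b 2)\<^sup>2) \<le> 1 + \<bar>t\<bar> / 4"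
    using A by (simp add: M_def)
qed

end
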